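(* Let $f$ be a real function that is monotone and continuous in a closed interval $I$. Then $f$ is continuously $\omega$-differentiable everywhere in the interior (opening) $I^{\circ}$ of $I$, that is, $f$ is $\omega$-differentiable at every point of $I^\circ$ with $\omega$-derivatives $\mathcal{D}^{\pm}_\omega f$ continuous on $I^\circ$.
   Context: For $\epsilon>0$ put $\Delta_\epsilon^{+}[f](x)=f(x+\epsilon)-f(x)$ and $\Delta_\epsilon^{-}[f](x)=f(x)-f(x-\epsilon)$. The point oscillation functions of a bounded function $f$ at $x$ are $\omega_x^{+}(\epsilon)=\sup_{u\in[x,x+\epsilon]}|f(u)-f(x)|$ and $\omega_x^{-}(\epsilon)=\sup_{u\in[x-\epsilon,x]}|f(x)-f(u)|$. The one-sided $\omega$-derivatives are the limits (when they exist as real numbers) $\mathcal{D}^{\pm}_\omega f(x)=\lim_{\epsilon\to 0^+}\Delta^{\pm}_\epsilon[f](x)/\omega^{\pm}_x(\epsilon)$; if $f$ is constant on $[x,x+\epsilon]$ (resp. $[x-\epsilon,x]$) for some $\epsilon>0$ the value is taken to be $0$. The function $f$ is $\omega$-differentiable at $x$ if at least one of the two limits exists; equality of $\mathcal{D}^{+}_\omega f(x)$ and $\mathcal{D}^{-}_\omega f(x)$ is not required.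
   Formalization: Continuity of the ω-derivatives is claimed only for f strictly monotone or constant on I, since it fails otherwise (e.g. max(0,x) on [-1,1] at 0); ω-differentiability on the interior, with both one-sided ω-derivatives existing, is proved for every monotone continuous f. *)

theory Defs
  imports "HOL-Analysis.Analysis"
begin

definition delta_right :: "real \<Rightarrow> (real \<Rightarrow> real) \<Rightarrow> real \<Rightarrow> real" where
  "delta_right \<epsilon> f x = f (x + \<epsilon>) - f x"

definition delta_left :: "real \<Rightarrow> (real \<Rightarrow> real) \<Rightarrow> real \<Rightarrow> real" where
  "delta_left \<epsilon> f x = f x - f (x - \<epsilon>)"

(* The suprema are meaningful where f is bounded.  At an interior point of an
   interval on which f is continuous this is so for all small \<epsilon>, and only
   those enter the limits below. *)

definition osc_right :: "(real \<Rightarrow> real) \<Rightarrow> real \<Rightarrow> real \<Rightarrow> real" where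
  "osc_right f x \<epsilon> = (SUP u\<in>{x..x + \<epsilon>}. \<bar>f u - f x\<bar>)"

definition osc_left :: "(real \<Rightarrow> real) \<Rightarrow> real \<Rightarrow> real \<Rightarrow> real" where
  "osc_left f x \<epsilon> = (SUP u\<in>{x - \<epsilon>..x}. \<bar>f x - f u\<bar>)"

definition has_omega_deriv_right :: "(real \<Rightarrow> real) \<Rightarrow> real \<Rightarrow> real \<Rightarrow> bool" where
  "has_omega_deriv_right f D x \<longleftrightarrow>
     (if \<exists>\<epsilon>>0. f constant_on {x..x + \<epsilon>} then D = 0
      else ((\<lambda>\<epsilon>. delta_right \<epsilon> f x / osc_right f x \<epsilon>) \<longlongrightarrow> D) (at_right 0))"

definition has_omega_deriv_left :: "(real \<Rightarrow> real) \<Rightarrow> real \<Rightarrow> real \<Rightarrow> bool" where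
  "has_omega_deriv_left f D x \<longleftrightarrow>
     (if \<exists>\<epsilon>>0. f constant_on {x - \<epsilon>..x} then D = 0
      else ((\<lambda>\<epsilon>. delta_left \<epsilon> f x / osc_left f x \<epsilon>) \<longlongrightarrow> D) (at_right 0))"

definition omega_differentiable_right :: "(real \<Rightarrow> real) \<Rightarrow> real \<Rightarrow> bool" where
  "omega_differentiable_right f x \<longleftrightarrow> (\<exists>D. has_omega_deriv_right f D x)"

definition omega_differentiable_left :: "(real \<Rightarrow> real) \<Rightarrow> real \<Rightarrow> bool" where
  "omega_differentiable_left f x \<longleftrightarrow> (\<exists>D. has_omega_deriv_left f D x)"

definition omega_differentiable :: "(real \<Rightarrow> real) \<Rightarrow> real \<Rightarrow> bool" where
  "omega_differentiable f x \<longleftrightarrow>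
     omega_differentiable_right f x \<or> omega_differentiable_left f x"

(* These carry information only where the corresponding one-sided limit exists. *)

definition omega_deriv_right :: "(real \<Rightarrow> real) \<Rightarrow> real \<Rightarrow> real" where
  "omega_deriv_right f x = (THE D. has_omega_deriv_right f D x)"

definition omega_deriv_left :: "(real \<Rightarrow> real) \<Rightarrow> real \<Rightarrow> real" where
  "omega_deriv_left f x = (THE D. has_omega_deriv_left f D x)"

end

(* Monotonicity makes the oscillation over [x, x + \<epsilon>] equal to the modulus of the increment, so the
   quotient defining the one-sided derivative is a sign: it is 0 where f is locally constant on that
   side, and otherwise constantly 1 or -1 according to the direction of monotonicity. In the
   injective and in the constant case the same alternative occurs at every interior point, so
   the derivatives are constant there. A sign s = 1 or s = -1 such that s f is increasing
   treats both directions of monotonicity at once, and u \<mapsto> - f (- u) exchanges left and right. *)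

theory Submission
  imports Defs
begin

text \<open>A monotone function is farthest from \<open>f x\<close> at the far endpoint, so the
  supremum is a maximum attained at \<open>x + \<epsilon>\<close>.\<close>

lemma osc_right_eq_abs_delta:
  fixes s :: real
  assumes "\<bar>s\<bar> = 1" "mono_on {x..x + \<epsilon>} (\<lambda>u. s * f u)" "0 \<le> \<epsilon>"
  shows "osc_right f x \<epsilon> = \<bar>delta_right \<epsilon> f x\<bar>"
proof -
  have "\<bar>f u - f x\<bar> \<le> \<bar>f (x + \<epsilon>) - f x\<bar>" if u: "u \<in> {x..x + \<epsilon>}" for u
  proof -
    have "s * f x \<le> s * f u" "s * f u \<le> s * f (x + \<epsilon>)"
      using u assms(3) by (auto intro!: mono_onD[OF assms(2)])
    moreover have "s = 1 \<or> s = -1" using assms(1) by linarith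
    ultimately show ?thesis by auto
  qed
  moreover have "x + \<epsilon> \<in> {x..x + \<epsilon>}" using assms(3) by simp
  ultimately show ?thesis
    unfolding osc_right_def delta_right_def by (intro cSup_eq_maximum) auto
qed

lemma has_omega_deriv_right_monotone:
  fixes s :: real
  assumes s: "\<bar>s\<bar> = 1" and mono: "mono_on {x..x + d} (\<lambda>u. s * f u)" and d: "0 < d"
  shows "has_omega_deriv_right f (if \<exists>\<epsilon>>0. f constant_on {x..x + \<epsilon>} then 0 else s) x"
proof (cases "\<exists>\<epsilon>>0. f constant_on {x..x + \<epsilon>}")
  case True
  then show ?thesis by (simp add: has_omega_deriv_right_def)
next
  case False
  have s1: "s = 1 \<or> s = -1" using s by linarith
  have quot: "delta_right \<epsilon> f x / osc_right f x \<epsilon> = s" if \<epsilon>: "0 < \<epsilon>" "\<epsilon> < d" for \<epsilon>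
  proof -
    have m: "mono_on {x..x + \<epsilon>} (\<lambda>u. s * f u)"
      using mono by (rule mono_on_subset) (use \<epsilon> in auto)
    have le: "s * f x \<le> s * f u" "s * f u \<le> s * f (x + \<epsilon>)" if "u \<in> {x..x + \<epsilon>}" for u
      using that \<epsilon> by (auto intro!: mono_onD[OF m])
    \<comment> \<open>Equal end values would squeeze every value in between by monotonicity, making
      \<open>f\<close> constant to the right of \<open>x\<close>, which the present case excludes.
      Hence the increment is nonzero and has the sign of \<open>s\<close>.\<close>
    have "f (x + \<epsilon>) \<noteq> f x"
    proof
      assume "f (x + \<epsilon>) = f x"
      with le s1 have "f u = f x" if "u \<in> {x..x + \<epsilon>}" for u
        using that by force
      then have "f constant_on {x..x + \<epsilon>}" unfolding constant_on_def by blast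
      with False \<epsilon> show False by blast
    qed
    then show ?thesis
      using s1 le(1)[of "x + \<epsilon>"] \<epsilon> osc_right_eq_abs_delta[OF s m]
      by (auto simp: delta_right_def divide_eq_eq)
  qed
  have "\<forall>\<^sub>F \<epsilon> in at_right 0. delta_right \<epsilon> f x / osc_right f x \<epsilon> = s"
    unfolding eventually_at_right_field using d quot by blast
  then have "((\<lambda>\<epsilon>. delta_right \<epsilon> f x / osc_right f x \<epsilon>) \<longlongrightarrow> s) (at_right 0)"
    by (rule tendsto_eventually)
  with False show ?thesis by (auto simp: has_omega_deriv_right_def)
qed

text \<open>Negation maps one interval onto the other, and the outer minus sign only replaces the
  constant value by its negative.\<close>

lemma constant_on_reflect_iff:
  fixes f :: "real \<Rightarrow> real"
  shows "(\<lambda>u. - f (- u)) constant_on {- x..- x + \<epsilon>} \<longleftrightarrow> f constant_on {x - \<epsilon>..x}"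
proof -
  have "(\<exists>y. \<forall>u\<in>A. - f (- u) = y) \<longleftrightarrow> (\<exists>y. \<forall>u\<in>A. f (- u) = y)" for A
    by (metis minus_minus)
  then have "(\<lambda>u. - f (- u)) constant_on A \<longleftrightarrow> f constant_on uminus ` A" for A
    unfolding constant_on_def ball_simps by blast
  then show ?thesis by simp
qed

text \<open>The inner negation swaps the sides and the outer one restores the sign of the increment,
  so the derivative \<open>D\<close> is carried over without a change of sign.\<close>

lemma has_omega_deriv_left_iff_right:
  "has_omega_deriv_left f D x \<longleftrightarrow> has_omega_deriv_right (\<lambda>u. - f (- u)) D (- x)"
proof -
  have "osc_right (\<lambda>u. - f (- u)) (- x) \<epsilon> = osc_left f x \<epsilon>" for \<epsilon>
  proof -
    have "(\<lambda>u. \<bar>f x - f u\<bar>) ` {x - \<epsilon>..x} = (\<lambda>u. \<bar>f x - f u\<bar>) ` uminus ` {- x..- x + \<epsilon>}"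
      by simp
    then show ?thesis
      unfolding osc_right_def osc_left_def image_image by simp
  qed
  moreover have "delta_right \<epsilon> (\<lambda>u. - f (- u)) (- x) = delta_left \<epsilon> f x" for \<epsilon>
    by (simp add: delta_right_def delta_left_def)
  ultimately show ?thesis
    unfolding has_omega_deriv_left_def has_omega_deriv_right_def constant_on_reflect_iff by auto
qed

lemma has_omega_deriv_left_monotone:
  fixes s :: real
  assumes s: "\<bar>s\<bar> = 1" and mono: "mono_on {x - d..x} (\<lambda>u. s * f u)" and d: "0 < d"
  shows "has_omega_deriv_left f (if \<exists>\<epsilon>>0. f constant_on {x - \<epsilon>..x} then 0 else s) x"
proof -
  \<comment> \<open>The two negations each reverse the order, so the reflected function keeps the
    direction of monotonicity and the same \<open>s\<close> serves.\<close>
  have "mono_on {- x..- x + d} (\<lambda>u. s * - f (- u))"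
    by (auto intro!: mono_onI mono_onD[OF mono])
  from has_omega_deriv_right_monotone[OF s this d] show ?thesis
    unfolding has_omega_deriv_left_iff_right constant_on_reflect_iff .
qed

text \<open>This evaluates the definite description. Which branch applies depends on
  \<open>f\<close> and \<open>x\<close> only, and in the limit branch the value is unique because
  \<open>at_right 0\<close> is a nontrivial filter.\<close>

lemma omega_deriv_right_eqI:
  assumes "has_omega_deriv_right f D x"
  shows "omega_deriv_right f x = D"
  unfolding omega_deriv_right_def
proof (rule the_equality)
  show "has_omega_deriv_right f D x" by (rule assms)
next
  fix D' assume "has_omega_deriv_right f D' x"
  with assms show "D' = D"
    unfolding has_omega_deriv_right_def
    by (auto split: if_splits intro: tendsto_unique[OF trivial_limit_at_right_real])
qed

lemma omega_deriv_left_eqI: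
  assumes "has_omega_deriv_left f D x"
  shows "omega_deriv_left f x = D"
proof -
  have "omega_deriv_left f x = omega_deriv_right (\<lambda>u. - f (- u)) (- x)"
    by (simp add: omega_deriv_left_def omega_deriv_right_def has_omega_deriv_left_iff_right)
  with assms show ?thesis
    by (simp add: has_omega_deriv_left_iff_right omega_deriv_right_eqI)
qed

lemma inj_on_not_constant_on:
  assumes "inj_on f S" "x \<in> S" "y \<in> S" "x \<noteq> y"
  shows "\<not> f constant_on S"
  using assms unfolding constant_on_def inj_on_def by metis

lemma not_locally_constant_if_inj_on:
  fixes f :: "real \<Rightarrow> real"
  assumes inj: "inj_on f {x - d..x + d}" and d: "0 < d" and \<epsilon>: "0 < \<epsilon>"
  shows "\<not> f constant_on {x..x + \<epsilon>}" "\<not> f constant_on {x - \<epsilon>..x}"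
proof -
  \<comment> \<open>The interval of length \<open>\<epsilon>\<close> may leave the region where
    \<open>f\<close> is known to be injective; shrinking to \<open>e\<close> keeps it inside, and
    constancy would pass to the smaller interval.\<close>
  define e where "e = min d \<epsilon>"
  have e: "0 < e" "e \<le> d" "e \<le> \<epsilon>" using d \<epsilon> by (auto simp: e_def)
  have "\<not> f constant_on {x..x + e}"
    by (rule inj_on_not_constant_on[where x = x and y = "x + e"])
      (use e in \<open>auto intro: inj_on_subset[OF inj]\<close>)
  then show "\<not> f constant_on {x..x + \<epsilon>}"
    using e by (meson constant_on_subset atLeastatMost_subset_iff add_left_mono order_refl)
  have "\<not> f constant_on {x - e..x}"
    by (rule inj_on_not_constant_on[where x = x and y = "x - e"])
      (use e in \<open>auto intro: inj_on_subset[OF inj]\<close>)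
  then show "\<not> f constant_on {x - \<epsilon>..x}"
    using e by (meson constant_on_subset atLeastatMost_subset_iff diff_left_mono order_refl)
qed

text \<open>Monotonicity and continuity alone do not prevent the derivatives from jumping: for
  \<open>\<lambda>x. max 0 x\<close> on \<open>{-1..1}\<close> the right one jumps from 0 to 1 at 0.
  The continuity claim is therefore made for strictly monotone and for constant
  \<open>f\<close>.\<close>

theorem proposition4:
  fixes f :: "real \<Rightarrow> real" and I :: "real set"
  assumes "is_interval I" and "closed I"
    and "mono_on I f \<or> antimono_on I f"
    and "continuous_on I f"
  shows "(\<forall>x\<in>interior I. omega_differentiable f x
             \<and> omega_differentiable_right f x \<and> omega_differentiable_left f x)
       \<and> (strict_mono_on I f \<or> strict_antimono_on I f \<or> f constant_on I \<longrightarrow>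
             continuous_on (interior I) (omega_deriv_right f)
           \<and> continuous_on (interior I) (omega_deriv_left f))"
proof -
  obtain s :: real where s: "\<bar>s\<bar> = 1" and mono: "mono_on I (\<lambda>u. s * f u)"
  proof (cases "mono_on I f")
    case True
    then show ?thesis using that[of 1] by simp
  next
    case False
    then show ?thesis using assms(3) that[of "-1"] by (auto simp: monotone_on_def)
  qed
  have nbhd: "\<exists>d>0. {x - d..x + d} \<subseteq> I" if "x \<in> interior I" for x
    using that by (auto simp: mem_interior_cball cball_eq_atLeastAtMost)
  have right: "has_omega_deriv_right f (if \<exists>\<epsilon>>0. f constant_on {x..x + \<epsilon>} then 0 else s) x"
    and left: "has_omega_deriv_left f (if \<exists>\<epsilon>>0. f constant_on {x - \<epsilon>..x} then 0 else s) x"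
    if "x \<in> interior I" for x
  proof -
    obtain d where d: "0 < d" "{x - d..x + d} \<subseteq> I" using nbhd \<open>x \<in> interior I\<close> by blast
    have "mono_on {x..x + d} (\<lambda>u. s * f u)" "mono_on {x - d..x} (\<lambda>u. s * f u)"
      by (rule mono_on_subset[OF mono], use d in force)+
    then show "has_omega_deriv_right f (if \<exists>\<epsilon>>0. f constant_on {x..x + \<epsilon>} then 0 else s) x"
      "has_omega_deriv_left f (if \<exists>\<epsilon>>0. f constant_on {x - \<epsilon>..x} then 0 else s) x"
      using s d has_omega_deriv_right_monotone has_omega_deriv_left_monotone by blast+
  qed
  have "continuous_on (interior I) (omega_deriv_right f)
      \<and> continuous_on (interior I) (omega_deriv_left f)"
    if "strict_mono_on I f \<or> strict_antimono_on I f \<or> f constant_on I"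
  proof -
    have "\<exists>c. \<forall>x\<in>interior I. omega_deriv_right f x = c \<and> omega_deriv_left f x = c"
    proof (cases "f constant_on I")
      case True
      have "omega_deriv_right f x = 0 \<and> omega_deriv_left f x = 0" if x: "x \<in> interior I" for x
      proof -
        obtain d where d: "0 < d" "{x - d..x + d} \<subseteq> I" using nbhd x by blast
        have "f constant_on {x..x + d}" "f constant_on {x - d..x}"
          by (rule constant_on_subset[OF True], use d in force)+
        with d(1) omega_deriv_right_eqI[OF right[OF x]] omega_deriv_left_eqI[OF left[OF x]]
        show ?thesis by auto
      qed
      then show ?thesis by blast
    next
      case False
      with that have "strict_mono_on I f \<or> strict_antimono_on I f" by blast
      \<comment> \<open>Injectivity covers both strict directions at once and excludes constancy on
        any nondegenerate interval beside an interior point, so both derivatives take the value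
        \<open>s\<close>.\<close>
      then have inj: "inj_on f I"
        by (intro linorder_inj_onI') (auto simp: monotone_on_def, fastforce+)
      have "omega_deriv_right f x = s \<and> omega_deriv_left f x = s" if x: "x \<in> interior I" for x
      proof -
        obtain d where d: "0 < d" "{x - d..x + d} \<subseteq> I" using nbhd x by blast
        from not_locally_constant_if_inj_on[OF inj_on_subset[OF inj d(2)] d(1)]
          omega_deriv_right_eqI[OF right[OF x]] omega_deriv_left_eqI[OF left[OF x]]
        show ?thesis by auto
      qed
      then show ?thesis by blast
    qed
    then show ?thesis by (metis continuous_on_const continuous_on_cong)
  qed
  moreover have "omega_differentiable_right f x \<and> omega_differentiable_left f x"
    if "x \<in> interior I" for x
    unfolding omega_differentiable_right_def omega_differentiable_left_def
    using right[OF that] left[OF that] by blast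
  ultimately show ?thesis unfolding omega_differentiable_def by blast
qed

end
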